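(* Every infinite prime graph which does not contain an infinite clique embeds at least one of the four graphs $G_0, G_1, G_2, G_3$.
   Context: Graphs are undirected, simple and without loops (possibly infinite). A graph $G=(V,\mathcal E)$ embeds a graph $G'$ if $G'$ is isomorphic to an induced subgraph of $G$. A subset $A\subseteq V$ is autonomous in $G$ if every $v\in V\setminus A$ is either adjacent to all vertices of $A$ or adjacent to no vertex of $A$. The empty set, the singletons and $V$ are the trivial autonomous sets. $G$ is prime if it has more than three vertices and all its autonomous sets are trivial. The graphs $G_0,G_1,G_2$ have vertex set $A\cup B$ where $A=\{a_i: i\in\mathbb N\}$ and $B=\{b_i: i\in\mathbb N\}$ are disjoint independent sets (all listed vertices distinct). The edges are: in $G_0$, the pairs $\{a_i,b_j\}$ with $i\neq j$; in $G_1$, the pairs $\{a_i,b_j\}$ with $i\le j$; in $G_2$, the pairs $\{a_i,b_j\}$ with $j=i$ or $j=i+1$ (so $G_2$ is the one-way infinite path). The graph $G_3$ has vertex set $A\cup B\cup\{c\}$, where $c$ is a new vertex, and its edges are the pairs $\{a_i,b_i\}$ and $\{c,b_i\}$, $i\in\mathbb N$. *)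

theory Defs
  imports Main
begin

record 'a graph =
  verts :: "'a set"
  edges :: "'a set set"

definition simple_graph :: "'a graph \<Rightarrow> bool" where
  "simple_graph G \<longleftrightarrow>
     (\<forall>e\<in>edges G. \<exists>x\<in>verts G. \<exists>y\<in>verts G. x \<noteq> y \<and> e = {x, y})"

definition adjacent :: "'a graph \<Rightarrow> 'a \<Rightarrow> 'a \<Rightarrow> bool" where
  "adjacent G x y \<longleftrightarrow> {x, y} \<in> edges G"

definition induced_subgraph :: "'a graph \<Rightarrow> 'a set \<Rightarrow> 'a graph" where
  "induced_subgraph G W = \<lparr>verts = W, edges = {e \<in> edges G. e \<subseteq> W}\<rparr>"

definition isomorphic :: "'a graph \<Rightarrow> 'b graph \<Rightarrow> bool" where
  "isomorphic G H \<longleftrightarrow>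
     (\<exists>f. bij_betw f (verts G) (verts H) \<and>
          (\<forall>x\<in>verts G. \<forall>y\<in>verts G. adjacent G x y \<longleftrightarrow> adjacent H (f x) (f y)))"

definition embeds :: "'a graph \<Rightarrow> 'b graph \<Rightarrow> bool" where
  "embeds G H \<longleftrightarrow> (\<exists>W\<subseteq>verts G. isomorphic H (induced_subgraph G W))"

definition autonomous :: "'a graph \<Rightarrow> 'a set \<Rightarrow> bool" where
  "autonomous G A \<longleftrightarrow>
     A \<subseteq> verts G \<and>
     (\<forall>v\<in>verts G - A. (\<forall>a\<in>A. adjacent G v a) \<or> (\<forall>a\<in>A. \<not> adjacent G v a))"

(* The finiteness disjunct is needed because card of an infinite set is 0. *)
definition prime_graph :: "'a graph \<Rightarrow> bool" where
  "prime_graph G \<longleftrightarrow>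
     (infinite (verts G) \<or> card (verts G) > 3) \<and>
     (\<forall>A. autonomous G A \<longrightarrow> A = {} \<or> (\<exists>x\<in>verts G. A = {x}) \<or> A = verts G)"

definition clique :: "'a graph \<Rightarrow> 'a set \<Rightarrow> bool" where
  "clique G K \<longleftrightarrow>
     K \<subseteq> verts G \<and> (\<forall>x\<in>K. \<forall>y\<in>K. x \<noteq> y \<longrightarrow> adjacent G x y)"

datatype vertex = a nat | b nat | c

definition G0 :: "vertex graph" where
  "G0 = \<lparr>verts = range a \<union> range b, edges = {{a i, b j} | i j. i \<noteq> j}\<rparr>"

definition G1 :: "vertex graph" where
  "G1 = \<lparr>verts = range a \<union> range b, edges = {{a i, b j} | i j. i \<le> j}\<rparr>"

definition G2 :: "vertex graph" where
  "G2 = \<lparr>verts = range a \<union> range b, edges = {{a i, b j} | i j. j = i \<or> j = i + 1}\<rparr>"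

definition G3 :: "vertex graph" where
  "G3 = \<lparr>verts = range a \<union> range b \<union> {c},
         edges = {{a i, b i} | i. True} \<union> {{c, b i} | i. True}\<rparr>"

(* a, b, c are common variable names; keep only the qualified constructor names. *)
hide_const (open) a b c

end

theory Submission
  imports "HOL-Library.Ramsey" Defs
begin

text \<open>
  Take a finite clique \<open>K\<close>, maximal among those whose common neighbourhood \<open>N\<close> is infinite;
  it exists because there is no infinite clique, and \<open>G[N]\<close> is then locally finite. An infinite
  component of \<open>G[N]\<close> contains an induced ray, which is \<open>G\<^sub>2\<close>. Otherwise all components of
  \<open>G[N]\<close> are finite, and primality provides vertices outside \<open>N \<union> K\<close> that separate pairs of
  isolated vertices of \<open>G[N]\<close> or ends of edges of nontrivial components. A single vertex that
  splits edges in infinitely many components yields \<open>G\<^sub>3\<close>; otherwise, by Ramsey's theorem, one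
  obtains an independent set \<open>{s\<^sub>i}\<close> in \<open>N\<close> and an independent set \<open>{y\<^sub>i}\<close> of separating vertices
  that induce \<open>G\<^sub>0\<close>, \<open>G\<^sub>1\<close> or an infinite induced matching. In the last case infinitely many
  \<open>y\<^sub>i\<close> miss the same element of \<open>K\<close>, which serves as the centre of a copy of \<open>G\<^sub>3\<close>.
\<close>

section \<open>Embedding the four graphs\<close>

lemma adjacent_sym: "adjacent G x y \<longleftrightarrow> adjacent G y x"
  by (simp add: adjacent_def insert_commute)

lemma adjacent_irrefl: "simple_graph G \<Longrightarrow> \<not> adjacent G x x"
  unfolding simple_graph_def adjacent_def by (metis doubleton_eq_iff)

lemma adjacent_verts:
  "simple_graph G \<Longrightarrow> adjacent G x y \<Longrightarrow> x \<in> verts G \<and> y \<in> verts G"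
  unfolding simple_graph_def adjacent_def by (metis doubleton_eq_iff)

lemma embedsI:
  assumes "inj_on f (verts H)" "f ` verts H \<subseteq> verts G"
    and "\<And>x y. x \<in> verts H \<Longrightarrow> y \<in> verts H \<Longrightarrow> adjacent H x y \<longleftrightarrow> adjacent G (f x) (f y)"
  shows "embeds G H"
  unfolding embeds_def isomorphic_def
proof (intro exI conjI)
  show "f ` verts H \<subseteq> verts G" by fact
  show "bij_betw f (verts H) (verts (induced_subgraph G (f ` verts H)))"
    using assms(1) by (simp add: induced_subgraph_def bij_betw_def)
  show "\<forall>x\<in>verts H. \<forall>y\<in>verts H. adjacent H x y
      \<longleftrightarrow> adjacent (induced_subgraph G (f ` verts H)) (f x) (f y)"
    using assms(3) by (auto simp: induced_subgraph_def adjacent_def)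
qed

text \<open>\<open>G0\<close>, \<open>G1\<close> and \<open>G2\<close> differ only in the relation
  \<open>P\<close> between the indices, so one criterion serves all three.\<close>

lemma embeds_bipartiteI:
  fixes p q :: "nat \<Rightarrow> 'v"
  assumes H: "H = \<lparr>verts = range vertex.a \<union> range vertex.b,
      edges = {{vertex.a i, vertex.b j} | i j. P i j}\<rparr>"
    and inj: "inj p" "inj q" and disj: "\<And>i j. p i \<noteq> q j"
    and verts: "range p \<subseteq> verts G" "range q \<subseteq> verts G"
    and indep: "\<And>i j. \<not> adjacent G (p i) (p j)" "\<And>i j. \<not> adjacent G (q i) (q j)"
    and adj: "\<And>i j. adjacent G (p i) (q j) \<longleftrightarrow> P i j"
  shows "embeds G H"
\<comment> \<open>\<open>vertex.c\<close> is not a vertex of \<open>H\<close>, so its image is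
  arbitrary.\<close>
proof (rule embedsI[where f = "case_vertex p q undefined"])
  show "inj_on (case_vertex p q undefined) (verts H)"
    using inj disj disj[symmetric] by (auto simp: inj_on_def H dest: injD)
  show "case_vertex p q undefined ` verts H \<subseteq> verts G"
    using verts by (auto simp: H)
  have adj': "adjacent G (q j) (p i) \<longleftrightarrow> P i j" for i j
    using adj adjacent_sym by metis
  show "adjacent H x y \<longleftrightarrow> adjacent G (case_vertex p q undefined x) (case_vertex p q undefined y)"
    if "x \<in> verts H" "y \<in> verts H" for x y
    using that by (auto simp: H adj adj' indep) (auto simp: adjacent_def doubleton_eq_iff)
qed

lemma embeds_G2I:
  assumes "inj v" "range v \<subseteq> verts G"
    and adj: "\<And>i j. adjacent G (v i) (v j) \<longleftrightarrow> j = Suc i \<or> i = Suc j"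
  shows "embeds G G2"
\<comment> \<open>Odd positions are the images of the vertices \<open>a i\<close>: on the ray,
  \<open>v (2 * i + 1)\<close> lies between \<open>v (2 * i)\<close> and
  \<open>v (2 * i + 2)\<close>, the images of \<open>b i\<close> and
  \<open>b (i + 1)\<close>.\<close>
proof (rule embeds_bipartiteI[OF G2_def, where p = "\<lambda>i. v (Suc (2 * i))" and q = "\<lambda>i. v (2 * i)"])
  show "inj (\<lambda>i. v (Suc (2 * i)))" "inj (\<lambda>i. v (2 * i))"
    by (auto intro!: injI dest!: injD[OF assms(1)])
  show "v (Suc (2 * i)) \<noteq> v (2 * j)" for i j
    using assms(1) by (metis Suc_double_not_eq_double injD)
  show "adjacent G (v (Suc (2 * i))) (v (2 * j)) \<longleftrightarrow> j = i \<or> j = i + 1" for i j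
    unfolding adj by presburger
  show "\<not> adjacent G (v (Suc (2 * i))) (v (Suc (2 * j)))"
    "\<not> adjacent G (v (2 * i)) (v (2 * j))" for i j
    unfolding adj by presburger+
qed (use assms(2) in auto)

lemma embeds_G3I:
  fixes p q :: "nat \<Rightarrow> 'v"
  assumes "simple_graph G" "inj p" "inj q" "\<And>i j. p i \<noteq> q j"
    and "x \<in> verts G" "range p \<subseteq> verts G" "range q \<subseteq> verts G"
    and "\<And>i j. \<not> adjacent G (p i) (p j)" "\<And>i j. \<not> adjacent G (q i) (q j)"
    and "\<And>i j. adjacent G (p i) (q j) \<longleftrightarrow> i = j"
    and "\<And>i. x \<noteq> p i" "\<And>i. \<not> adjacent G x (p i)" "\<And>i. adjacent G x (q i)"
  shows "embeds G G3"
proof (rule embedsI[where f = "case_vertex p q x"])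
  have x: "x \<noteq> q i" for i
    using assms(1,13) adjacent_irrefl by metis
  show "inj_on (case_vertex p q x) (verts G3)"
    using assms(2-4) assms(4,11)[symmetric] assms(11) x x[symmetric]
    by (auto simp: inj_on_def G3_def dest: injD)
  show "case_vertex p q x ` verts G3 \<subseteq> verts G"
    using assms(5-7) by (auto simp: G3_def)
  have adj': "adjacent G (q j) (p i) \<longleftrightarrow> i = j" "adjacent G (q j) x" "\<not> adjacent G (p j) x"
    "\<not> adjacent G x x" for i j
    using assms adjacent_sym adjacent_irrefl by metis+
  show "adjacent G3 u v \<longleftrightarrow> adjacent G (case_vertex p q x u) (case_vertex p q x v)"
    if "u \<in> verts G3" "v \<in> verts G3" for u v
    using that by (auto simp: G3_def assms(8-) adj') (auto simp: adjacent_def doubleton_eq_iff)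
qed

section \<open>Infinite combinatorics\<close>

text \<open>Ramsey's theorem colours unordered pairs, whereas \<open>P\<close> need not be
  symmetric. Reading each pair in increasing order turns \<open>P\<close> into a colouring, and the
  increasing enumeration of a homogeneous set respects this reading.\<close>

lemma ramsey_subsequence:
  fixes P :: "nat \<Rightarrow> nat \<Rightarrow> bool"
  obtains r :: "nat \<Rightarrow> nat" and \<beta> where "strict_mono r" "\<And>i j. i < j \<Longrightarrow> P (r i) (r j) = \<beta>"
proof -
  define f where "f S = (if P (Min S) (Max S) then 1 else 0 :: nat)" for S
  have "f S < 2" for S
    by (simp add: f_def)
  then have "\<exists>Y t. Y \<subseteq> UNIV \<and> infinite Y \<and> t < 2 \<and> (\<forall>x\<in>Y. \<forall>y\<in>Y. x \<noteq> y \<longrightarrow> f {x, y} = t)"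
    by (intro Ramsey2 infinite_UNIV_nat) blast
  then obtain Y t where Y: "infinite Y" "\<forall>x\<in>Y. \<forall>y\<in>Y. x \<noteq> y \<longrightarrow> f {x, y} = t"
    by (elim exE conjE)
  have r: "strict_mono (enumerate Y)"
    using Y(1) by (rule strict_mono_enumerate)
  have "P (enumerate Y i) (enumerate Y j) = (t = 1)" if "i < j" for i j
  proof -
    have "enumerate Y i < enumerate Y j"
      using r that by (rule strict_monoD)
    then show ?thesis
      using Y(2)[rule_format, OF enumerate_in_set[OF Y(1), of i] enumerate_in_set[OF Y(1), of j]]
      by (simp add: f_def min_def max_def split: if_splits)
  qed
  with r show ?thesis by (rule that)
qed

lemma pigeonhole_subsequence:
  fixes P :: "'a \<Rightarrow> nat \<Rightarrow> bool"
  assumes "finite K" "\<And>i. \<exists>x\<in>K. P x i"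
  obtains r :: "nat \<Rightarrow> nat" and x where "strict_mono r" "x \<in> K" "\<And>i. P x (r i)"
proof -
  have "(\<Union>x\<in>K. {i. P x i}) = UNIV"
    using assms(2) by auto
  then have "\<exists>x\<in>K. infinite {i. P x i}"
    using assms(1) by (metis finite_UN infinite_UNIV_nat)
  then obtain x where x: "x \<in> K" "infinite {i. P x i}" ..
  have "P x (enumerate {i. P x i} i)" for i
    using enumerate_in_set[OF x(2)] by blast
  with x strict_mono_enumerate show ?thesis by (metis that)
qed

text \<open>Dependent choice in which each new element only has to suit the finitely many earlier
  ones; the extension step may use that these satisfy \<open>Q\<close>.\<close>

lemma greedy_sequence:
  assumes "\<And>F. finite F \<Longrightarrow> (\<And>z. z \<in> F \<Longrightarrow> Q z) \<Longrightarrow> \<exists>x. Q x \<and> (\<forall>z\<in>F. R z x)"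
  obtains f :: "nat \<Rightarrow> 'a" where "\<And>n. Q (f n)" "\<And>i j. i < j \<Longrightarrow> R (f i) (f j)"
proof -
  have "\<exists>f. \<forall>n::nat. Q (f n) \<and> (\<forall>i<n. R (f i) (f n))"
  proof (rule dependent_wellorder_choice)
    fix n :: nat and f :: "nat \<Rightarrow> 'a"
    assume "\<And>i. i < n \<Longrightarrow> Q (f i) \<and> (\<forall>j<i. R (f j) (f i))"
    then have "\<exists>x. Q x \<and> (\<forall>z\<in>f ` {..<n}. R z x)"
      by (intro assms) auto
    then show "\<exists>x. Q x \<and> (\<forall>i<n. R (f i) x)"
      by auto
  qed simp
  then obtain f where "\<forall>n::nat. Q (f n) \<and> (\<forall>i<n. R (f i) (f n))" ..
  with that[of f] show ?thesis by simp
qed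

text \<open>Koenig's lemma, applied to the edges that increase the distance \<open>d\<close> from
  \<open>u\<close> by one. Vertex number \<open>n\<close> of the resulting ray has distance
  \<open>n\<close>, which excludes repetitions; chords are excluded because the distances of
  adjacent vertices differ by at most one.\<close>

lemma induced_ray:
  fixes R :: "('a \<times> 'a) set"
  assumes "sym R" "irrefl R" "\<And>u. finite (R `` {u})" "infinite (R\<^sup>* `` {u})"
  obtains v :: "nat \<Rightarrow> 'a" where "inj v" "range v \<subseteq> R\<^sup>* `` {u}"
    "\<And>i j. (v i, v j) \<in> R \<longleftrightarrow> j = Suc i \<or> i = Suc j"
proof -
  define d where "d w = (LEAST n. (u, w) \<in> R ^^ n)" for w
  define P where "P = {(x, w). (x, w) \<in> R \<and> d w = Suc (d x)}"
  have d: "(u, w) \<in> R ^^ d w" if "(u, w) \<in> R\<^sup>*" for w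
    using that unfolding d_def by (metis LeastI rtrancl_imp_relpow)
  have d_le: "d w \<le> n" if "(u, w) \<in> R ^^ n" for w n
    using that unfolding d_def by (rule Least_le)
  have d0: "d u = 0"
    using d_le[of u 0] by simp
  have d_step: "d w \<le> Suc (d x)" if "(u, x) \<in> R\<^sup>*" "(x, w) \<in> R" for x w
    using d_le d that by (metis relpow_Suc_I)
  \<comment> \<open>The last edge of a shortest path from \<open>u\<close> belongs to
    \<open>P\<close>, so passing from \<open>R\<close> to \<open>P\<close> loses no reachable
    vertex.\<close>
  have reach: "(u, w) \<in> P\<^sup>*" if "(u, w) \<in> R ^^ n" "d w = n" for w n
    using that
  proof (induction n arbitrary: w)
    case (Suc n)
    then obtain x where x: "(u, x) \<in> R ^^ n" "(x, w) \<in> R" by auto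
    then have "d x \<le> n" "(u, x) \<in> R\<^sup>*"
      using d_le by (auto simp: relpow_imp_rtrancl)
    then have "d x = n"
      using d_step x Suc.prems(2) by fastforce
    then have "(u, x) \<in> P\<^sup>*" "(x, w) \<in> P"
      using Suc x by (auto simp: P_def)
    then show ?case by simp
  qed simp
  have "R\<^sup>* `` {u} \<subseteq> P\<^sup>* `` {u}"
    using d reach by blast
  then have inf: "infinite (P\<^sup>* `` {u})"
    using assms(4) finite_subset by blast
  \<comment> \<open>Apart from \<open>x\<close> itself, whatever is reachable from \<open>x\<close>
    is reachable from one of its finitely many \<open>P\<close>-successors.\<close>
  have step: "\<exists>y. (x, y) \<in> P \<and> infinite (P\<^sup>* `` {y})" if "infinite (P\<^sup>* `` {x})" for x
  proof (rule ccontr)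
    assume neg: "\<not> ?thesis"
    have "P\<^sup>* `` {x} \<subseteq> insert x (\<Union>y\<in>P `` {x}. P\<^sup>* `` {y})"
      by (auto elim: converse_rtranclE)
    moreover have "finite (P `` {x})"
      by (rule finite_subset[OF _ assms(3)[of x]]) (auto simp: P_def)
    moreover have "finite (\<Union>y\<in>P `` {x}. P\<^sup>* `` {y})" if "finite (P `` {x})"
      using that neg by blast
    ultimately show False
      using that by (metis finite_insert finite_subset)
  qed
  \<comment> \<open>The clause for \<open>n = 0\<close> fixes the start \<open>u\<close>, which
    dependent choice alone would leave open.\<close>
  have "\<exists>v. \<forall>n. infinite (P\<^sup>* `` {v n}) \<and> (n = 0 \<longrightarrow> v n = u) \<and> (v n, v (Suc n)) \<in> P"
  proof -
    have "\<exists>v. \<forall>n. (infinite (P\<^sup>* `` {v n}) \<and> (n = 0 \<longrightarrow> v n = u)) \<and> (v n, v (Suc n)) \<in> P"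
    proof (rule dependent_nat_choice)
      show "\<exists>x. infinite (P\<^sup>* `` {x}) \<and> (0 = (0::nat) \<longrightarrow> x = u)"
        using inf by blast
      show "\<exists>y. (infinite (P\<^sup>* `` {y}) \<and> (Suc n = 0 \<longrightarrow> y = u)) \<and> (x, y) \<in> P"
        if "infinite (P\<^sup>* `` {x}) \<and> (n = 0 \<longrightarrow> x = u)" for x n
        using step that by blast
    qed
    then show ?thesis by simp
  qed
  then obtain v where "\<forall>n. infinite (P\<^sup>* `` {v n}) \<and> (n = 0 \<longrightarrow> v n = u) \<and> (v n, v (Suc n)) \<in> P" ..
  then have v0: "v 0 = u" and vP: "\<And>n. (v n, v (Suc n)) \<in> P" by simp_all
  have vd: "d (v n) = n" for n
  proof (induction n)
    case (Suc n)
    then show ?case using vP[of n] by (simp add: P_def)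
  qed (simp add: v0 d0)
  have vR: "(v n, v (Suc n)) \<in> R" for n
    using vP by (auto simp: P_def)
  have reach_v: "(u, v n) \<in> R\<^sup>*" for n
  proof (induction n)
    case (Suc n)
    then show ?case using vR by (rule rtrancl_into_rtrancl)
  qed (simp add: v0)
  show ?thesis
  proof
    show "inj v" using vd by (metis injI)
    show "range v \<subseteq> R\<^sup>* `` {u}" using reach_v by auto
    show "(v i, v j) \<in> R \<longleftrightarrow> j = Suc i \<or> i = Suc j" for i j
    proof
      assume R: "(v i, v j) \<in> R"
      then have R': "(v j, v i) \<in> R" using assms(1) by (rule symD[rotated])
      have "d (v j) \<le> Suc (d (v i))" "d (v i) \<le> Suc (d (v j))"
        using d_step reach_v R R' by blast+
      then have "j \<le> Suc i" "i \<le> Suc j"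
        by (simp_all add: vd)
      moreover have "i \<noteq> j"
        using R assms(2) by (auto simp: irrefl_def)
      ultimately show "j = Suc i \<or> i = Suc j" by linarith
    next
      assume "j = Suc i \<or> i = Suc j"
      then show "(v i, v j) \<in> R" using vR assms(1) by (auto dest: symD)
    qed
  qed
qed

text \<open>If \<open>y\<close> separates \<open>s\<close> from \<open>t\<close>, every element of
  an infinite set \<open>T\<close> disagrees with exactly one of them with respect to
  \<open>y\<close>, so one of the two has infinitely many opponents in \<open>T\<close>. Keep it
  together with \<open>y\<close>, shrink \<open>T\<close> to the opponents and repeat: every later
  element then disagrees with the one kept.\<close>

lemma separating_sequence:
  fixes E :: "'a \<Rightarrow> 'b \<Rightarrow> bool"
  assumes "infinite S"
    and "\<And>s t. s \<in> S \<Longrightarrow> t \<in> S \<Longrightarrow> s \<noteq> t \<Longrightarrow> \<exists>y\<in>Y. E y s \<noteq> E y t"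
  obtains s :: "nat \<Rightarrow> 'b" and y :: "nat \<Rightarrow> 'a" and \<epsilon> where
    "range s \<subseteq> S" "range y \<subseteq> Y" "\<And>i. E (y i) (s i) \<longleftrightarrow> \<not> \<epsilon>"
    "\<And>i j. i < j \<Longrightarrow> E (y i) (s j) \<longleftrightarrow> \<epsilon>"
proof -
  have split: "\<exists>T' s y. infinite T' \<and> T' \<subseteq> T \<and> s \<in> T \<and> y \<in> Y \<and> (\<forall>t\<in>T'. E y t \<noteq> E y s)"
    if T: "infinite T" "T \<subseteq> S" for T
  proof -
    obtain s t where st: "s \<in> T" "t \<in> T" "s \<noteq> t"
      using T(1) by (metis finite.emptyI finite_insert finite_subset insertI1 subset_iff)
    then obtain y where y: "y \<in> Y" "E y s \<noteq> E y t"
      using assms(2) T(2) by blast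
    have "T = {t'\<in>T. E y t' \<noteq> E y s} \<union> {t'\<in>T. E y t' \<noteq> E y t}"
      using y by auto
    then consider "infinite {t'\<in>T. E y t' \<noteq> E y s}" | "infinite {t'\<in>T. E y t' \<noteq> E y t}"
      using T(1) by (metis finite_Un)
    then show ?thesis
    proof cases
      case 1
      then show ?thesis using st y
        by (intro exI[of _ "{t'\<in>T. E y t' \<noteq> E y s}"] exI[of _ s] exI[of _ y]) auto
    next
      case 2
      then show ?thesis using st y
        by (intro exI[of _ "{t'\<in>T. E y t' \<noteq> E y t}"] exI[of _ t] exI[of _ y]) auto
    qed
  qed
  have "\<exists>T. \<forall>n::nat. (infinite (T n) \<and> T n \<subseteq> S) \<and> (T (Suc n) \<subseteq> T n
      \<and> (\<exists>s y. s \<in> T n \<and> y \<in> Y \<and> (\<forall>t\<in>T (Suc n). E y t \<noteq> E y s)))"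
  proof (rule dependent_nat_choice)
    show "\<exists>T. infinite T \<and> T \<subseteq> S"
      using assms(1) by blast
    show "\<exists>T'. (infinite T' \<and> T' \<subseteq> S) \<and> (T' \<subseteq> T
      \<and> (\<exists>s y. s \<in> T \<and> y \<in> Y \<and> (\<forall>t\<in>T'. E y t \<noteq> E y s)))"
      if T: "infinite T \<and> T \<subseteq> S" for T n
    proof -
      obtain T' s y where "infinite T'" "T' \<subseteq> T" "s \<in> T" "y \<in> Y" "\<forall>t\<in>T'. E y t \<noteq> E y s"
        using split T by metis
      then show ?thesis using T by blast
    qed
  qed
  then obtain T where "\<forall>n::nat. (infinite (T n) \<and> T n \<subseteq> S) \<and> (T (Suc n) \<subseteq> T n
      \<and> (\<exists>s y. s \<in> T n \<and> y \<in> Y \<and> (\<forall>t\<in>T (Suc n). E y t \<noteq> E y s)))" ..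
  then have T: "\<And>n. T n \<subseteq> S" "\<And>n. T (Suc n) \<subseteq> T n"
    and ex: "\<forall>n. \<exists>p. fst p \<in> T n \<and> snd p \<in> Y \<and> (\<forall>t\<in>T (Suc n). E (snd p) t \<noteq> E (snd p) (fst p))"
    by simp_all
  have "\<exists>p. \<forall>n. fst (p n) \<in> T n \<and> snd (p n) \<in> Y
      \<and> (\<forall>t\<in>T (Suc n). E (snd (p n)) t \<noteq> E (snd (p n)) (fst (p n)))"
    using choice[OF ex] .
  then obtain p where p: "\<forall>n. fst (p n) \<in> T n \<and> snd (p n) \<in> Y
      \<and> (\<forall>t\<in>T (Suc n). E (snd (p n)) t \<noteq> E (snd (p n)) (fst (p n)))" ..
  define s y where "s n = fst (p n)" and "y n = snd (p n)" for n
  have sy: "\<And>n. s n \<in> T n" "\<And>n. y n \<in> Y"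
    "\<And>n t. t \<in> T (Suc n) \<Longrightarrow> E (y n) t \<noteq> E (y n) (s n)"
    using p by (simp_all add: s_def y_def)
  have mono: "T j \<subseteq> T i" if "i \<le> j" for i j
    using T(2) that by (rule lift_Suc_antimono_le)
  have later: "E (y i) (s j) \<noteq> E (y i) (s i)" if "i < j" for i j
    using sy(1,3) mono[of "Suc i" j] that by (meson Suc_leI subsetD)
  \<comment> \<open>So far the value on the diagonal may depend on the index; thinning makes it
    constant, and the values beyond the diagonal are its negation.\<close>
  obtain r :: "nat \<Rightarrow> nat" and \<epsilon> where r: "strict_mono r" "\<epsilon> \<in> UNIV" "\<And>i. E (y (r i)) (s (r i)) \<longleftrightarrow> \<not> \<epsilon>"
    by (rule pigeonhole_subsequence[of UNIV "\<lambda>\<epsilon> i. E (y i) (s i) \<longleftrightarrow> \<not> \<epsilon>"]) auto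
  show ?thesis
  proof
    show "range (s \<circ> r) \<subseteq> S" "range (y \<circ> r) \<subseteq> Y"
      using T(1) sy by auto
    show "E ((y \<circ> r) i) ((s \<circ> r) i) \<longleftrightarrow> \<not> \<epsilon>" for i
      using r(3) by simp
    show "E ((y \<circ> r) i) ((s \<circ> r) j) \<longleftrightarrow> \<epsilon>" if "i < j" for i j
      using later[of "r i" "r j"] r that by (simp add: strict_monoD)
  qed
qed

section \<open>Separated sequences\<close>

text \<open>View adjacency between the \<open>y i\<close> and the \<open>s j\<close> as a matrix,
  known on and above the diagonal. One use of Ramsey's theorem makes the \<open>y i\<close>
  independent, since an infinite clique is excluded; a second makes the entries below the diagonal a
  constant \<beta>. The values of \<epsilon> and \<beta> then determine the graph.\<close>

lemma separated_sequence_cases: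
  fixes s y :: "nat \<Rightarrow> 'v"
  assumes "simple_graph G" "\<not> (\<exists>K. clique G K \<and> infinite K)"
    and verts: "range s \<subseteq> verts G" "range y \<subseteq> verts G" and disj: "\<And>i j. y i \<noteq> s j"
    and indep: "\<And>i j. \<not> adjacent G (s i) (s j)"
    and diag: "\<And>i. adjacent G (y i) (s i) \<longleftrightarrow> \<not> \<epsilon>"
    and above: "\<And>i j. i < j \<Longrightarrow> adjacent G (y i) (s j) \<longleftrightarrow> \<epsilon>"
  obtains "embeds G G0" | "embeds G G1"
  | r :: "nat \<Rightarrow> nat" where "inj (y \<circ> r)" "inj (s \<circ> r)"
      "\<And>i j. \<not> adjacent G (y (r i)) (y (r j))"
      "\<And>i j. adjacent G (y (r i)) (s (r j)) \<longleftrightarrow> i = j"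
proof -
  \<comment> \<open>Row \<open>i\<close> distinguishes \<open>s i\<close> from \<open>s j\<close>,
    and column \<open>j\<close> distinguishes \<open>y i\<close> from \<open>y j\<close>.\<close>
  have "s i \<noteq> s j" "y i \<noteq> y j" if "i < j" for i j
    using diag[of i] diag[of j] above[OF that] by metis+
  then have "inj s" "inj y"
    by (auto intro: linorder_injI)
  obtain r1 :: "nat \<Rightarrow> nat" and \<alpha> where r1: "strict_mono r1"
    "\<And>i j. i < j \<Longrightarrow> adjacent G (y (r1 i)) (y (r1 j)) = \<alpha>"
    using ramsey_subsequence[of "\<lambda>i j. adjacent G (y i) (y j)"] by blast
  have "inj (y \<circ> r1)"
    using \<open>inj y\<close> r1(1) by (simp add: inj_compose strict_mono_imp_inj_on)
  have all: "adjacent G (y (r1 i)) (y (r1 j)) = \<alpha>" if "i \<noteq> j" for i j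
  proof (cases "i < j")
    case False
    with that have "j < i" by simp
    then show ?thesis
      using r1(2)[of j i] adjacent_sym[of G "y (r1 i)" "y (r1 j)"] by simp
  qed (rule r1(2))
  have "\<not> \<alpha>"
  proof
    assume \<alpha>
    have "clique G (range (y \<circ> r1))"
      unfolding clique_def
    proof (intro conjI ballI impI)
      show "range (y \<circ> r1) \<subseteq> verts G"
        using verts(2) by auto
      fix u v assume "u \<in> range (y \<circ> r1)" "v \<in> range (y \<circ> r1)" "u \<noteq> v"
      then obtain i j where "u = y (r1 i)" "v = y (r1 j)" "i \<noteq> j"
        by auto
      then show "adjacent G u v"
        using all \<open>\<alpha>\<close> by simp
    qed
    then show False
      using assms(2) \<open>inj (y \<circ> r1)\<close> by (metis finite_imageD infinite_UNIV_nat)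
  qed
  then have indep_y: "\<not> adjacent G (y (r1 i)) (y (r1 j))" for i j
    using all adjacent_irrefl[OF assms(1)] by (cases "i = j") simp_all
  obtain r2 :: "nat \<Rightarrow> nat" and \<beta> where r2: "strict_mono r2"
    "\<And>i j. i < j \<Longrightarrow> adjacent G (y (r1 (r2 j))) (s (r1 (r2 i))) = \<beta>"
    using ramsey_subsequence[of "\<lambda>i j. adjacent G (y (r1 j)) (s (r1 i))"] by blast
  define p q where "p = (\<lambda>i. y (r1 (r2 i)))" and "q = (\<lambda>i. s (r1 (r2 i)))"
  have mono: "r1 (r2 i) < r1 (r2 j)" if "i < j" for i j
    using that r1(1) r2(1) by (simp add: strict_monoD)
  then have "inj (\<lambda>i. r1 (r2 i))"
    by (simp add: linorder_injI less_imp_neq)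
  then have inj: "inj p" "inj q"
    using \<open>inj s\<close> \<open>inj y\<close> by (auto simp: p_def q_def inj_def)
  have pq: "adjacent G (p i) (q j) \<longleftrightarrow> (if i = j then \<not> \<epsilon> else if i < j then \<epsilon> else \<beta>)" for i j
    using diag above[OF mono, of i j] r2(2)[of j i] by (auto simp: p_def q_def)
  then have qp: "adjacent G (q i) (p j) \<longleftrightarrow> (if i = j then \<not> \<epsilon> else if j < i then \<epsilon> else \<beta>)" for i j
    using adjacent_sym[of G "q i" "p j"] by auto
  have disj': "p i \<noteq> q j" "q j \<noteq> p i" for i j
    using disj[of "r1 (r2 i)" "r1 (r2 j)"] by (auto simp: p_def q_def)
  have verts': "range p \<subseteq> verts G" "range q \<subseteq> verts G"
    using verts by (auto simp: p_def q_def)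
  have indep': "\<not> adjacent G (p i) (p j)" "\<not> adjacent G (q i) (q j)" for i j
    using indep indep_y by (auto simp: p_def q_def)
  show ?thesis
  proof (cases \<epsilon>; cases \<beta>)
    assume "\<epsilon>" "\<beta>"
    then have "embeds G G0"
      by (intro embeds_bipartiteI[OF G0_def, of p q] inj disj' verts' indep') (simp add: pq)
    then show ?thesis by (rule that)
  next
    assume "\<epsilon>" "\<not> \<beta>"
    \<comment> \<open>Here \<open>p i\<close> is adjacent to \<open>q j\<close> iff
      \<open>i < j\<close>; shifting \<open>q\<close> by one turns this into the relation
      \<open>i \<le> j\<close> of \<open>G1\<close>.\<close>
    have "inj (\<lambda>j. q (Suc j))" "range (\<lambda>j. q (Suc j)) \<subseteq> verts G"
      using inj(2) verts'(2) by (auto simp: inj_def)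
    with \<open>\<epsilon>\<close> \<open>\<not> \<beta>\<close> have "embeds G G1"
      by (intro embeds_bipartiteI[OF G1_def, of p "\<lambda>j. q (Suc j)"] inj disj' verts' indep')
        (auto simp: pq)
    then show ?thesis by (rule that)
  next
    assume "\<not> \<epsilon>" "\<beta>"
    \<comment> \<open>Here \<open>p i\<close> is adjacent to \<open>q j\<close> iff
      \<open>j \<le> i\<close>, so the two sides exchange their roles.\<close>
    then have "embeds G G1"
      by (intro embeds_bipartiteI[OF G1_def, of q p] inj disj' verts' indep')
        (auto simp: qp)
    then show ?thesis by (rule that)
  next
    assume "\<not> \<epsilon>" "\<not> \<beta>"
    then have "adjacent G (p i) (q j) \<longleftrightarrow> i = j" for i j
      by (simp add: pq)
    with that(3)[of "\<lambda>i. r1 (r2 i)"] inj indep'(1) show ?thesis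
      by (simp add: p_def q_def comp_def)
  qed
qed

lemma embeds_if_separated_sequence:
  fixes s y :: "nat \<Rightarrow> 'v"
  assumes G: "simple_graph G" "\<not> (\<exists>K. clique G K \<and> infinite K)"
    and "range s \<subseteq> verts G" "range y \<subseteq> verts G" "\<And>i j. y i \<noteq> s j"
    and "\<And>i j. \<not> adjacent G (s i) (s j)"
    and "\<And>i. adjacent G (y i) (s i) \<longleftrightarrow> \<not> \<epsilon>"
    and "\<And>i j. i < j \<Longrightarrow> adjacent G (y i) (s j) \<longleftrightarrow> \<epsilon>"
    and K: "finite K" "K \<subseteq> verts G" "\<And>i. y i \<notin> K" "\<And>x i. x \<in> K \<Longrightarrow> adjacent G x (s i)"
    and nonadj: "\<And>i. \<exists>x\<in>K. \<not> adjacent G x (y i)"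
  shows "embeds G G0 \<or> embeds G G1 \<or> embeds G G3"
proof (rule separated_sequence_cases[OF assms(1-8)])
  fix r :: "nat \<Rightarrow> nat"
  assume matching: "inj (y \<circ> r)" "inj (s \<circ> r)"
    "\<And>i j. \<not> adjacent G (y (r i)) (y (r j))"
    "\<And>i j. adjacent G (y (r i)) (s (r j)) \<longleftrightarrow> i = j"
  obtain r' :: "nat \<Rightarrow> nat" and x where r': "strict_mono r'" "x \<in> K"
    "\<And>i. \<not> adjacent G x (y (r (r' i)))"
    using pigeonhole_subsequence[of K "\<lambda>x i. \<not> adjacent G x (y (r i))"] K(1) nonadj by blast
  have "inj r'"
    using r'(1) by (rule strict_mono_imp_inj_on)
  \<comment> \<open>The \<open>s\<close> side supplies the vertices \<open>b i\<close>, because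
    \<open>x\<close>, as an element of \<open>K\<close>, is adjacent to all of it.\<close>
  have "embeds G G3"
  proof (rule embeds_G3I[OF G(1), where p = "\<lambda>i. y (r (r' i))" and q = "\<lambda>i. s (r (r' i))" and x = x])
    show "inj (\<lambda>i. y (r (r' i)))" "inj (\<lambda>i. s (r (r' i)))"
      using matching(1,2) \<open>inj r'\<close> by (auto simp: inj_def)
    show "adjacent G (y (r (r' i))) (s (r (r' j))) \<longleftrightarrow> i = j" for i j
      using matching(4) \<open>inj r'\<close> by (simp add: inj_eq)
    show "x \<noteq> y (r (r' i))" for i
      using r'(2) K(3) by metis
  qed (use r' K matching assms(3-6) in auto)
  then show ?thesis by blast
qed auto

section \<open>Maximal cliques with infinitely many common neighbours\<close>

definition common_nbrs :: "'v graph \<Rightarrow> 'v set \<Rightarrow> 'v set" where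
  "common_nbrs G K = {v \<in> verts G. \<forall>x\<in>K. adjacent G x v}"

text \<open>If some common neighbour \<open>x\<close> of \<open>K\<close> has infinitely many
  neighbours among the common neighbours, these are exactly the common neighbours of
  \<open>insert x K\<close>. Were this always so, finite cliques could be extended forever, and the
  union of the chain would be an infinite clique.\<close>

lemma exists_maximal_clique:
  assumes G: "simple_graph G" "infinite (verts G)"
    and no_clique: "\<not> (\<exists>K. clique G K \<and> infinite K)"
  obtains K where "finite K" "K \<subseteq> verts G" "infinite (common_nbrs G K)"
    "\<And>x. x \<in> common_nbrs G K \<Longrightarrow> finite {v \<in> common_nbrs G K. adjacent G x v}"
proof (rule ccontr)
  note extremal = that
  assume neg: "\<not> ?thesis"
  define P where "P K \<longleftrightarrow> clique G K \<and> finite K \<and> infinite (common_nbrs G K)" for K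
  have step: "\<exists>K'. P K' \<and> K \<subset> K'" if "P K" for K
  proof -
    have "finite K" "K \<subseteq> verts G" "infinite (common_nbrs G K)"
      using \<open>P K\<close> by (simp_all add: P_def clique_def)
    note K = this
    have "\<not> (\<forall>x\<in>common_nbrs G K. finite {v \<in> common_nbrs G K. adjacent G x v})"
    proof
      assume "\<forall>x\<in>common_nbrs G K. finite {v \<in> common_nbrs G K. adjacent G x v}"
      then have thesis
        by (intro extremal[OF K]) simp
      with neg show False ..
    qed
    then obtain x where
      x: "x \<in> common_nbrs G K" "infinite {v \<in> common_nbrs G K. adjacent G x v}"
      by blast
    have "common_nbrs G (insert x K) = {v \<in> common_nbrs G K. adjacent G x v}"
      by (auto simp: common_nbrs_def)
    moreover have "adjacent G z x" "adjacent G x z" if "z \<in> K" for z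
      using x(1) that adjacent_sym[of G x z] by (simp_all add: common_nbrs_def)
    then have "clique G (insert x K)"
      using x(1) \<open>P K\<close> by (auto simp: P_def clique_def common_nbrs_def)
    moreover have "x \<notin> K"
      using x(1) adjacent_irrefl[OF G(1)] by (auto simp: common_nbrs_def)
    ultimately have "P (insert x K)" "K \<subset> insert x K"
      using x \<open>P K\<close> by (auto simp: P_def)
    then show ?thesis by blast
  qed
  \<comment> \<open>The common neighbourhood of the empty clique is the whole vertex set.\<close>
  have "P {}"
    using G(2) by (simp add: P_def clique_def common_nbrs_def)
  then have "\<exists>K. \<forall>n::nat. P (K n) \<and> K n \<subset> K (Suc n)"
  proof (intro dependent_nat_choice)
    show "\<exists>K'. P K' \<and> K \<subset> K'" if "P K" for K and n :: nat
      using that by (rule step)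
  qed blast
  then obtain K where "\<forall>n::nat. P (K n) \<and> K n \<subset> K (Suc n)" ..
  then have K: "P (K n)" "K n \<subset> K (Suc n)" for n :: nat
    by simp_all
  have mono: "K i \<subseteq> K j" if "i \<le> j" for i j
    using K(2) that by (metis lift_Suc_mono_le psubset_imp_subset)
  have "clique G (\<Union>n. K n)"
    unfolding clique_def
  proof (intro conjI ballI impI)
    show "(\<Union>n. K n) \<subseteq> verts G"
      using K(1) by (auto simp: P_def clique_def)
    fix x z assume "x \<in> (\<Union>n. K n)" "z \<in> (\<Union>n. K n)" "x \<noteq> z"
    then obtain i j where "x \<in> K i" "z \<in> K j" by auto
    then have "x \<in> K (max i j)" "z \<in> K (max i j)"
      using mono[of i "max i j"] mono[of j "max i j"] by auto
    then show "adjacent G x z"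
      using K(1)[of "max i j"] \<open>x \<noteq> z\<close> by (auto simp: P_def clique_def)
  qed
  moreover have "infinite (\<Union>n. K n)"
  proof
    assume fin: "finite (\<Union>n. K n)"
    have "n \<le> card (K n)" for n
    proof (induction n)
      case (Suc n)
      have "card (K n) < card (K (Suc n))"
        using K(1)[of "Suc n"] K(2) by (intro psubset_card_mono) (auto simp: P_def)
      with Suc show ?case by simp
    qed simp
    moreover have "card (K n) \<le> card (\<Union>n. K n)" for n
      using fin by (intro card_mono) auto
    ultimately show False
      by (meson Suc_n_not_le_n order_trans)
  qed
  ultimately show False
    using no_clique by blast
qed

section \<open>Components of the graph induced on the common neighbourhood\<close>

locale prime_graph_with_maximal_clique =
  fixes G :: "'v graph" and K :: "'v set"
  assumes simple: "simple_graph G" and inf_verts: "infinite (verts G)" and prime: "prime_graph G"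
    and no_clique: "\<not> (\<exists>K. clique G K \<and> infinite K)"
    and finite_K: "finite K" and K_verts: "K \<subseteq> verts G"
    and inf_nbrs: "infinite (common_nbrs G K)"
    and locally_finite: "\<And>x. x \<in> common_nbrs G K \<Longrightarrow> finite {v \<in> common_nbrs G K. adjacent G x v}"
begin

abbreviation N :: "'v set" where "N \<equiv> common_nbrs G K"

text \<open>As a relation, \<open>R\<close> makes components available as images of singletons under
  \<open>R\<^sup>*\<close>. A vertex outside \<open>N\<close> forms a component of its own, so
  finiteness of components can be assumed for all \<open>u\<close>.\<close>

definition R :: "('v \<times> 'v) set" where
  "R = {(u, v). u \<in> N \<and> v \<in> N \<and> adjacent G u v}"

lemma sym_R: "sym R"
  by (auto simp: R_def sym_def adjacent_sym)

lemma irrefl_R: "irrefl R"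
  by (auto simp: R_def irrefl_def adjacent_irrefl[OF simple])

lemma finite_R_image: "finite (R `` {u})"
proof (cases "u \<in> N")
  case True
  then show ?thesis
    using locally_finite[OF True] by (auto simp: R_def)
qed (auto simp: R_def)

lemma sym_rtrancl_R: "(u, v) \<in> R\<^sup>* \<Longrightarrow> (v, u) \<in> R\<^sup>*"
  using sym_rtrancl[OF sym_R] by (rule symD)

lemma rtrancl_R_N: "(u, v) \<in> R\<^sup>* \<Longrightarrow> u \<in> N \<Longrightarrow> v \<in> N"
  by (induction rule: rtrancl_induct) (auto simp: R_def)

lemma N_verts: "N \<subseteq> verts G"
  by (auto simp: common_nbrs_def)

lemma K_adjacent_N: "x \<in> K \<Longrightarrow> v \<in> N \<Longrightarrow> adjacent G x v"
  by (auto simp: common_nbrs_def)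

text \<open>A finite set with two elements is nontrivial because the graph is infinite; primality
  therefore yields an outside vertex that splits it.\<close>

lemma not_autonomous:
  assumes "finite A" "A \<subseteq> verts G" "u \<in> A" "v \<in> A" "u \<noteq> v"
  obtains y s t where "y \<in> verts G - A" "s \<in> A" "t \<in> A" "adjacent G y s" "\<not> adjacent G y t"
proof -
  have "\<not> autonomous G A"
    using prime assms inf_verts unfolding prime_graph_def by blast
  then show ?thesis
    using assms(2) that unfolding autonomous_def by blast
qed

text \<open>Vertices that separate two elements of the neighbourhood lie outside the clique, so they
  miss one of its elements; by finiteness of the clique, infinitely many of them miss the same.\<close>

lemma embeds_if_separated_in_N:
  fixes s y :: "nat \<Rightarrow> 'v"
  assumes "range s \<subseteq> N" "range y \<subseteq> verts G - N - K"
    and indep: "\<And>i j. \<not> adjacent G (s i) (s j)"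
    and sep: "\<And>i. adjacent G (y i) (s i) \<longleftrightarrow> \<not> \<epsilon>"
      "\<And>i j. i < j \<Longrightarrow> adjacent G (y i) (s j) \<longleftrightarrow> \<epsilon>"
  shows "embeds G G0 \<or> embeds G G1 \<or> embeds G G3"
proof (rule embeds_if_separated_sequence[OF simple no_clique _ _ _ indep sep finite_K K_verts])
  have y: "y i \<in> verts G" "y i \<notin> N" "y i \<notin> K" and s: "s i \<in> N" for i
    using assms(1,2) by auto
  show "range s \<subseteq> verts G" "range y \<subseteq> verts G"
    using y s N_verts by auto
  show "y i \<noteq> s j" for i j
    using y s by metis
  show "y i \<notin> K" for i
    by (rule y)
  show "adjacent G x (s i)" if "x \<in> K" for x i
    using that s by (rule K_adjacent_N)
  show "\<exists>x\<in>K. \<not> adjacent G x (y i)" for i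
    using y[of i] by (auto simp: common_nbrs_def)
qed

section \<open>The cases of infinite components, isolated vertices and split edges\<close>

lemma embeds_if_infinite_component:
  assumes "infinite (R\<^sup>* `` {u})"
  shows "embeds G G2"
proof -
  obtain v :: "nat \<Rightarrow> 'v" where v: "inj v" "\<And>i j. (v i, v j) \<in> R \<longleftrightarrow> j = Suc i \<or> i = Suc j"
    using induced_ray[OF sym_R irrefl_R finite_R_image assms] by metis
  have N: "v i \<in> N" for i
    using v(2)[of i "Suc i"] by (auto simp: R_def)
  show ?thesis
  proof (rule embeds_G2I[OF v(1)])
    show "range v \<subseteq> verts G"
      using N N_verts by auto
    show "adjacent G (v i) (v j) \<longleftrightarrow> j = Suc i \<or> i = Suc j" for i j
      using v(2)[of i j] N by (auto simp: R_def)
  qed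
qed

text \<open>Since a pair of isolated vertices is not autonomous, some \<open>y\<close> separates it.
  This \<open>y\<close> is not in \<open>N\<close>, as it would be an \<open>R\<close>-neighbour of
  an isolated vertex, and not in \<open>K\<close>, whose elements are adjacent to both.\<close>

lemma embeds_if_infinitely_many_isolated:
  assumes "infinite {u \<in> N. R `` {u} = {}}" (is "infinite ?I")
  shows "embeds G G0 \<or> embeds G G1 \<or> embeds G G3"
proof -
  have sep: "\<exists>y\<in>verts G - N - K. adjacent G y s \<noteq> adjacent G y t"
    if "s \<in> ?I" "t \<in> ?I" "s \<noteq> t" for s t
  proof -
    have "{s, t} \<subseteq> verts G"
      using that N_verts by auto
    then obtain y s' t' where y: "y \<in> verts G - {s, t}" "s' \<in> {s, t}" "t' \<in> {s, t}"
      "adjacent G y s'" "\<not> adjacent G y t'"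
      by (rule not_autonomous[of "{s, t}" s t, rotated]) (use \<open>s \<noteq> t\<close> in auto)
    have "y \<notin> N"
    proof
      assume "y \<in> N"
      then have "(s', y) \<in> R"
        using y(2,4) that(1,2) adjacent_sym[of G y s'] by (auto simp: R_def)
      then show False
        using y(2) that(1,2) by blast
    qed
    moreover have "y \<notin> K"
      using y(3,5) that(1,2) K_adjacent_N[of y t'] by auto
    moreover have "adjacent G y s \<noteq> adjacent G y t"
      using y(2-5) by auto
    ultimately show ?thesis
      using y(1) by blast
  qed
  show ?thesis
  proof (rule separating_sequence[OF assms sep])
    fix s y :: "nat \<Rightarrow> 'v" and \<epsilon>
    assume sy: "range s \<subseteq> ?I" "range y \<subseteq> verts G - N - K"
      "\<And>i. adjacent G (y i) (s i) \<longleftrightarrow> \<not> \<epsilon>"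
      "\<And>i j. i < j \<Longrightarrow> adjacent G (y i) (s j) \<longleftrightarrow> \<epsilon>"
    have I: "s i \<in> ?I" for i
      using sy(1) by blast
    have "(s i, s j) \<notin> R" for i j
      using I[of i] by blast
    then have "\<not> adjacent G (s i) (s j)" for i j
      using I[of i] I[of j] by (simp add: R_def)
    moreover have "range s \<subseteq> N"
      using I by blast
    ultimately show ?thesis
      by (intro embeds_if_separated_in_N[OF _ sy(2) _ sy(3,4)])
  qed
qed

text \<open>A finite component with at least two vertices is not autonomous. A vertex
  \<open>y\<close> that splits it is not in \<open>N\<close>, as it would then belong to the
  component, and not in \<open>K\<close>, whose elements see all of \<open>N\<close>.\<close>

lemma separated_edge:
  assumes fin: "finite (R\<^sup>* `` {u})" and u: "u \<in> N" "R `` {u} \<noteq> {}"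
  obtains y s t where "y \<in> verts G - N - K" "(u, s) \<in> R\<^sup>*" "(s, t) \<in> R"
    "adjacent G y s" "\<not> adjacent G y t"
proof -
  let ?C = "R\<^sup>* `` {u}"
  obtain v where v: "(u, v) \<in> R" using u by blast
  then have "u \<noteq> v" using irrefl_R by (auto simp: irrefl_def)
  have C: "?C \<subseteq> N" using u rtrancl_R_N by auto
  obtain y s t where y: "y \<in> verts G - ?C" "s \<in> ?C" "t \<in> ?C"
    "adjacent G y s" "\<not> adjacent G y t"
    by (rule not_autonomous[OF fin, of u v]) (use C v \<open>u \<noteq> v\<close> N_verts in auto)
  have "y \<notin> N"
  proof
    assume "y \<in> N"
    then have "(s, y) \<in> R"
      using y(2,4) C adjacent_sym[of G y s] by (auto simp: R_def)
    with y(2) have "y \<in> ?C"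
      by (auto intro: rtrancl_into_rtrancl)
    with y(1) show False by blast
  qed
  moreover have "y \<notin> K"
    using y C K_adjacent_N by blast
  \<comment> \<open>On a path inside the component from a neighbour of \<open>y\<close> to a
    non-neighbour, adjacency to \<open>y\<close> is lost along some edge.\<close>
  moreover have "\<exists>s' t'. (u, s') \<in> R\<^sup>* \<and> (s', t') \<in> R \<and> adjacent G y s' \<and> \<not> adjacent G y t'"
  proof -
    have "(s, t) \<in> R\<^sup>*"
      using y(2,3) sym_rtrancl_R by (auto intro: rtrancl_trans)
    from this y(5) show ?thesis
    proof (induction rule: rtrancl_induct)
      case (step v w)
      have "(u, v) \<in> R\<^sup>*"
        using step.hyps(1) y(2) by (auto intro: rtrancl_trans)
      with step show ?case by blast
    qed (use y(4) in blast)
  qed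
  ultimately show ?thesis
    using y(1) that by blast
qed

text \<open>No edge of \<open>N\<close> joins different components, so one end of each edge may be
  selected freely and the selection stays independent.\<close>

lemma different_components:
  assumes "\<And>i j. i < j \<Longrightarrow> (s i, s j) \<notin> R\<^sup>*" and st: "\<And>i::nat. (s i, t i) \<in> R"
    and "i \<noteq> j" "x \<in> {s i, t i}" "y \<in> {s j, t j}"
  shows "x \<noteq> y" "\<not> adjacent G x y"
proof -
  have sij: "(s i, s j) \<notin> R\<^sup>*"
    using assms(1)[of i j] assms(1)[of j i] \<open>i \<noteq> j\<close> sym_rtrancl_R by (metis linorder_neqE_nat)
  have "(s i, x) \<in> R\<^sup>*" "(y, s j) \<in> R\<^sup>*"
    using assms(4,5) st sym_rtrancl_R by auto
  with sij have xy: "(x, y) \<notin> R\<^sup>*"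
    by (meson rtrancl_trans)
  then show "x \<noteq> y" by auto
  have "x \<in> N" "y \<in> N"
    using assms(4,5) st[of i] st[of j] by (auto simp: R_def)
  with xy show "\<not> adjacent G x y"
    by (auto simp: R_def)
qed

definition split_edges :: "'v \<Rightarrow> ('v \<times> 'v) set" where
  "split_edges y = {(s, t) \<in> R. adjacent G y s \<and> \<not> adjacent G y t}"

text \<open>Finite components contain finitely many edges each, so the edges split by
  \<open>y\<close> meet infinitely many components. One from each gives an induced matching with
  centre \<open>y\<close>: the ends adjacent to \<open>y\<close> serve as \<open>b i\<close>, the
  others as \<open>a i\<close>.\<close>

lemma embeds_if_infinite_split_edges:
  assumes fin: "\<And>u. finite (R\<^sup>* `` {u})" and y: "y \<in> verts G - N" "infinite (split_edges y)"
  shows "embeds G G3"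
proof -
  have "\<exists>e. e \<in> split_edges y \<and> (\<forall>e'\<in>F. (fst e', fst e) \<notin> R\<^sup>*)" if "finite F" for F
  proof (rule ccontr)
    assume neg: "\<not> ?thesis"
    define B where "B = (\<Union>e'\<in>F. R\<^sup>* `` {fst e'})"
    \<comment> \<open>Otherwise every split edge would start in one of the finitely many components
      that \<open>F\<close> meets.\<close>
    have "split_edges y \<subseteq> Sigma B (\<lambda>s. R `` {s})"
      using neg by (fastforce simp: B_def split_edges_def)
    moreover have "finite (Sigma B (\<lambda>s. R `` {s}))"
      using that fin finite_R_image by (auto simp: B_def simp del: Image_singleton_iff)
    ultimately show False
      using y(2) finite_subset by blast
  qed
  then obtain f :: "nat \<Rightarrow> 'v \<times> 'v" where f: "\<And>n. f n \<in> split_edges y"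
    "\<And>i j. i < j \<Longrightarrow> (fst (f i), fst (f j)) \<notin> R\<^sup>*"
    using greedy_sequence[of "\<lambda>e. e \<in> split_edges y" "\<lambda>e' e. (fst e', fst e) \<notin> R\<^sup>*"] by metis
  define s t where "s n = fst (f n)" and "t n = snd (f n)" for n
  have st: "(s n, t n) \<in> R" "adjacent G y (s n)" "\<not> adjacent G y (t n)" for n
    using f(1)[of n] by (auto simp: split_edges_def s_def t_def)
  have comp: "(s i, s j) \<notin> R\<^sup>*" if "i < j" for i j
    using f(2)[OF that] by (simp add: s_def)
  note diff = different_components[of s t, OF comp st(1)]
  have N: "s n \<in> N" "t n \<in> N" for n
    using st(1)[of n] by (auto simp: R_def)
  show ?thesis
  proof (rule embeds_G3I[OF simple, of t s y])
    show "inj t" "inj s"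
      using diff(1) by (auto intro!: injI)
    show "t i \<noteq> s j" for i j
      using st(2)[of j] st(3)[of i] by auto
    show "\<not> adjacent G (t i) (t j)" "\<not> adjacent G (s i) (s j)" for i j
      using diff(2)[of i j "t i" "t j"] diff(2)[of i j "s i" "s j"] adjacent_irrefl[OF simple]
      by auto
    show "adjacent G (t i) (s j) \<longleftrightarrow> i = j" for i j
      using diff(2)[of i j "t i" "s j"] st(1)[of i] adjacent_sym[of G "t i"] by (auto simp: R_def)
    show "y \<noteq> t i" for i
      using y(1) N by auto
  qed (use y N N_verts st in auto)
qed

text \<open>As each \<open>y\<close> splits only finitely many edges, separated edges can be chosen
  one after another so that no earlier \<open>y\<close> splits a later edge. An earlier
  \<open>y\<close> then treats both ends of a later edge alike, and the end of each edge can be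
  picked afterwards to suit the value found by Ramsey's theorem.\<close>

lemma embeds_if_infinitely_many_nonisolated:
  assumes fin: "\<And>u. finite (R\<^sup>* `` {u})" and inf: "infinite {u \<in> N. R `` {u} \<noteq> {}}" (is "infinite ?U")
    and split: "\<And>y. y \<in> verts G - N \<Longrightarrow> finite (split_edges y)"
  shows "embeds G G0 \<or> embeds G G1 \<or> embeds G G3"
proof -
  define Q where "Q = (\<lambda>(y, s, t). y \<in> verts G - N - K \<and> (s, t) \<in> split_edges y)"
  \<comment> \<open>An earlier triple stands before a later one. Both orientations of the later edge
    are excluded, so the earlier \<open>y\<close> does not distinguish its ends.\<close>
  define D where "D = (\<lambda>(y, s, t :: 'v) (y' :: 'v, s', t' :: 'v).
    (s, s') \<notin> R\<^sup>* \<and> (s', t') \<notin> split_edges y \<and> (t', s') \<notin> split_edges y)"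
  have "\<exists>z. Q z \<and> (\<forall>z'\<in>F. D z' z)" if F: "finite F" "\<And>z. z \<in> F \<Longrightarrow> Q z" for F
  proof -
    \<comment> \<open>A component avoiding \<open>X\<close> is new and contains no end of an edge
      split by an earlier \<open>y\<close>. As \<open>X\<close> and all components are finite,
      infinitely many candidates \<open>u\<close> remain.\<close>
    define X where "X = (\<Union>(y, s, t)\<in>F. insert s (fst ` split_edges y \<union> snd ` split_edges y))"
    have "finite X"
      using F split by (fastforce simp: X_def Q_def)
    then have "finite (\<Union>x\<in>X. R\<^sup>* `` {x})"
      using fin by blast
    then obtain u where u: "u \<in> ?U" "u \<notin> (\<Union>x\<in>X. R\<^sup>* `` {x})"
      using inf by (meson finite_subset subsetI)
    from u(1) have "u \<in> N" "R `` {u} \<noteq> {}" by simp_all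
    then obtain y s t where y: "y \<in> verts G - N - K" "(u, s) \<in> R\<^sup>*" "(s, t) \<in> R"
      "adjacent G y s" "\<not> adjacent G y t"
      by (rule separated_edge[OF fin])
    have X: "x \<in> X \<Longrightarrow> (x, s) \<notin> R\<^sup>*" for x
      using u(2) sym_rtrancl_R[OF y(2)] by (auto intro: rtrancl_trans)
    have "s \<notin> X"
      using X by blast
    have "D (y', s', t') (y, s, t)" if "(y', s', t') \<in> F" for y' s' t'
      unfolding D_def prod.case
    proof (intro conjI)
      have sub: "insert s' (fst ` split_edges y' \<union> snd ` split_edges y') \<subseteq> X"
        using that unfolding X_def by blast
      then show "(s', s) \<notin> R\<^sup>*"
        using X by auto
      show "(s, t) \<notin> split_edges y'" "(t, s) \<notin> split_edges y'"
        using sub \<open>s \<notin> X\<close> by force+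
    qed
    moreover have "Q (y, s, t)"
      using y by (auto simp: Q_def split_edges_def)
    ultimately show ?thesis by fastforce
  qed
  then obtain f :: "nat \<Rightarrow> 'v \<times> 'v \<times> 'v" where f: "\<And>n. Q (f n)" "\<And>i j. i < j \<Longrightarrow> D (f i) (f j)"
    using greedy_sequence[of Q D] by metis
  define y s t where "y n = fst (f n)" and "s n = fst (snd (f n))" and "t n = snd (snd (f n))" for n
  have fn: "f n = (y n, s n, t n)" for n
    by (simp add: y_def s_def t_def)
  have y: "y n \<in> verts G - N - K" and st: "(s n, t n) \<in> R"
    and ys: "adjacent G (y n) (s n)" and yt: "\<not> adjacent G (y n) (t n)" for n
    using f(1)[of n] by (auto simp: fn Q_def split_edges_def)
  have comp: "(s i, s j) \<notin> R\<^sup>*" if "i < j" for i j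
    using f(2)[OF that] by (simp add: fn D_def)
  have same: "adjacent G (y i) (s j) \<longleftrightarrow> adjacent G (y i) (t j)" if "i < j" for i j
    using f(2)[OF that] st[of j] symD[OF sym_R st[of j]] by (auto simp: fn D_def split_edges_def)
  note diff = different_components[of s t, OF comp st]
  have N: "s n \<in> N" "t n \<in> N" for n
    using st[of n] by (auto simp: R_def)
  obtain r :: "nat \<Rightarrow> nat" and \<alpha> where r: "strict_mono r"
    "\<And>i j. i < j \<Longrightarrow> adjacent G (y (r i)) (s (r j)) = \<alpha>"
    using ramsey_subsequence[of "\<lambda>i j. adjacent G (y i) (s j)"] by blast
  \<comment> \<open>The chosen end has the value opposite to \<alpha> at its own
    \<open>y (r i)\<close>, while by \<open>same\<close> every earlier \<open>y\<close> has value
    \<alpha> at either end.\<close>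
  define w where "w i = (if \<alpha> then t (r i) else s (r i))" for i
  show ?thesis
  proof (rule embeds_if_separated_in_N[where s = w and y = "\<lambda>i. y (r i)" and \<epsilon> = \<alpha>])
    show "range w \<subseteq> N" "range (\<lambda>i. y (r i)) \<subseteq> verts G - N - K"
      using N y by (auto simp: w_def)
    show "adjacent G (y (r i)) (w i) \<longleftrightarrow> \<not> \<alpha>" for i
      using ys yt by (simp add: w_def)
    show "adjacent G (y (r i)) (w j) \<longleftrightarrow> \<alpha>" if "i < j" for i j
      using r(2)[OF that] same[of "r i" "r j"] strict_monoD[OF r(1) that] by (simp add: w_def)
    show "\<not> adjacent G (w i) (w j)" for i j
    proof (cases "i = j")
      case True
      then show ?thesis using adjacent_irrefl[OF simple] by simp
    next
      case False
      then have "r i \<noteq> r j"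
        using strict_mono_eq[OF r(1)] by simp
      then show ?thesis
        by (intro diff(2)[of "r i" "r j"]) (auto simp: w_def)
    qed
  qed
qed

lemma embeds_one_of_four: "embeds G G0 \<or> embeds G G1 \<or> embeds G G2 \<or> embeds G G3"
proof (rule ccontr)
  assume neg: "\<not> ?thesis"
  have fin: "finite (R\<^sup>* `` {u})" for u
    using embeds_if_infinite_component[of u] neg by argo
  have split: "finite (split_edges y)" if "y \<in> verts G - N" for y
    using embeds_if_infinite_split_edges[OF fin that] neg by argo
  have "N \<subseteq> {u \<in> N. R `` {u} = {}} \<union> {u \<in> N. R `` {u} \<noteq> {}}"
    by auto
  then have "infinite {u \<in> N. R `` {u} = {}} \<or> infinite {u \<in> N. R `` {u} \<noteq> {}}"
    using inf_nbrs by (meson finite_UnI finite_subset)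
  then have "embeds G G0 \<or> embeds G G1 \<or> embeds G G3"
  proof
    assume "infinite {u \<in> N. R `` {u} = {}}"
    then show ?thesis by (rule embeds_if_infinitely_many_isolated)
  next
    assume "infinite {u \<in> N. R `` {u} \<noteq> {}}"
    then show ?thesis by (rule embeds_if_infinitely_many_nonisolated[OF fin _ split])
  qed
  with neg show False by argo
qed

end

theorem theorem2:
  fixes G :: "'v graph"
  assumes "simple_graph G"
    and "infinite (verts G)"
    and "prime_graph G"
    and "\<not> (\<exists>K. clique G K \<and> infinite K)"
  shows "embeds G G0 \<or> embeds G G1 \<or> embeds G G2 \<or> embeds G G3"
proof -
  obtain K where K: "finite K" "K \<subseteq> verts G" "infinite (common_nbrs G K)"
    "\<And>x. x \<in> common_nbrs G K \<Longrightarrow> finite {v \<in> common_nbrs G K. adjacent G x v}"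
    by (rule exists_maximal_clique[OF assms(1,2,4)]) blast
  interpret prime_graph_with_maximal_clique G K
    by (rule prime_graph_with_maximal_clique.intro[OF assms K])
  show ?thesis by (rule embeds_one_of_four)
qed

end
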